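(* Let $T$ be a finite tree with $n$ vertices. Then for every vertex $v\in V(T)$, $$RC(v) + (2n-1)\,CC(v) = 4(n-1)W(T),$$ so in particular this quantity is independent of $v$. Consequently, a vertex $v$ maximizes $CC(v)$ over $V(T)$ if and only if it minimizes $RC(v)$, and vice versa.
   Context: For a finite connected graph, the simple random walk moves at each step from its current vertex to a uniformly random neighbour. The hitting time $H_{vw}$ is the expected number of steps for the simple random walk started at $v$ to first reach $w$ ($H_{vv}=0$). The cover cost is $CC(v)=\sum_{w} H_{vw}$, the reverse cover cost is $RC(v)=\sum_{w} H_{wv}$, and the Wiener index is $W(T)=\sum_{\{x,y\}\subseteq V(T)} d(x,y)$, where $d$ is the graph distance. *)

theory Defs
  imports "HOL-Probability.Probability"
begin

section \<open>Finite simple graphs and trees\<close>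

text \<open>A graph is given by its vertex set \<open>V\<close> and its edge set \<open>E\<close>, a set of two-element
  subsets of \<open>V\<close>.\<close>

definition fin_graph :: "'a set \<Rightarrow> 'a set set \<Rightarrow> bool" where
  "fin_graph V E \<longleftrightarrow> finite V \<and> (\<forall>e\<in>E. e \<subseteq> V \<and> card e = 2)"

definition walk_between :: "'a set \<Rightarrow> 'a set set \<Rightarrow> 'a \<Rightarrow> 'a list \<Rightarrow> 'a \<Rightarrow> bool" where
  "walk_between V E u xs v \<longleftrightarrow>
     xs \<noteq> [] \<and> set xs \<subseteq> V \<and> hd xs = u \<and> last xs = v \<and> successively (\<lambda>x y. {x, y} \<in> E) xs"

definition connected_graph :: "'a set \<Rightarrow> 'a set set \<Rightarrow> bool" where
  "connected_graph V E \<longleftrightarrow> V \<noteq> {} \<and> (\<forall>u\<in>V. \<forall>v\<in>V. \<exists>xs. walk_between V E u xs v)"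

definition is_cycle :: "'a set set \<Rightarrow> 'a list \<Rightarrow> bool" where
  "is_cycle E xs \<longleftrightarrow>
     length xs \<ge> 3 \<and> distinct xs \<and> successively (\<lambda>x y. {x, y} \<in> E) xs \<and> {last xs, hd xs} \<in> E"

definition is_tree :: "'a set \<Rightarrow> 'a set set \<Rightarrow> bool" where
  "is_tree V E \<longleftrightarrow> fin_graph V E \<and> connected_graph V E \<and> (\<nexists>xs. is_cycle E xs)"

text \<open>A walk of \<open>k\<close> edges is a list of \<open>Suc k\<close> vertices.\<close>

definition gdist :: "'a set \<Rightarrow> 'a set set \<Rightarrow> 'a \<Rightarrow> 'a \<Rightarrow> nat" where
  "gdist V E u v = (LEAST k. \<exists>xs. walk_between V E u xs v \<and> length xs = Suc k)"

definition wiener_index :: "'a set \<Rightarrow> 'a set set \<Rightarrow> nat" where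
  "wiener_index V E =
     (\<Sum>S\<in>{S. S \<subseteq> V \<and> card S = 2}. THE d. \<exists>x y. S = {x, y} \<and> d = gdist V E x y)"

lemma walk_between_rev:
  assumes "walk_between V E u xs v" shows "walk_between V E v (rev xs) u"
  using assms by (auto simp: walk_between_def hd_rev last_rev insert_commute)

lemma gdist_commute: "gdist V E u v = gdist V E v u"
proof -
  have "(\<exists>xs. walk_between V E u xs v \<and> length xs = Suc k)
      \<longleftrightarrow> (\<exists>xs. walk_between V E v xs u \<and> length xs = Suc k)" for k
    by (metis walk_between_rev length_rev)
  then show ?thesis
    by (simp add: gdist_def)
qed

lemma the_gdist: "(THE d. \<exists>x y. {a, b} = {x, y} \<and> d = gdist V E x y) = gdist V E a b"
  by (rule the_equality) (auto simp: doubleton_eq_iff gdist_commute)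


section \<open>Simple random walk and hitting times\<close>

text \<open>If \<open>x\<close> has no neighbour, the step distribution is an unspecified pmf; in a connected
  graph this only happens for the one-vertex graph.\<close>

definition srw_step :: "'a set set \<Rightarrow> 'a \<Rightarrow> 'a pmf" where
  "srw_step E x = pmf_of_set {y. {x, y} \<in> E}"

definition srw_kernel :: "'a set set \<Rightarrow> 'a \<Rightarrow> nat \<Rightarrow> (nat \<Rightarrow> 'a) \<Rightarrow> 'a measure" where
  "srw_kernel E v n \<omega> =
     measure_pmf (case n of 0 \<Rightarrow> return_pmf v | Suc m \<Rightarrow> srw_step E (\<omega> m))"

text \<open>The law, on the space of infinite trajectories, of the simple random walk started at \<open>v\<close>:
  the Ionescu-Tulcea extension of the kernels above. The finite-dimensional distributions are
  computed in \<open>emeasure_srw\<close> below.\<close>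

definition srw :: "'a set set \<Rightarrow> 'a \<Rightarrow> (nat \<Rightarrow> 'a) measure" where
  "srw E v =
     projective_family.lim UNIV
       (Ionescu_Tulcea.CI (srw_kernel E v) (\<lambda>_. count_space UNIV)) (\<lambda>_. count_space UNIV)"

lemma Ionescu_Tulcea_srw: "Ionescu_Tulcea (srw_kernel E v) (\<lambda>_. count_space UNIV)"
proof (rule Ionescu_Tulcea.intro)
  fix n :: nat
  show "srw_kernel E v n \<in>
      PiM {0..<n} (\<lambda>_. count_space UNIV) \<rightarrow>\<^sub>M subprob_algebra (count_space UNIV)"
  proof (cases n)
    case 0
    then show ?thesis
      by (simp add: srw_kernel_def[abs_def] measure_pmf_in_subprob_algebra)
  next
    case (Suc m)
    have comp: "(\<lambda>\<omega>. \<omega> m) \<in> PiM {0..<n} (\<lambda>_. count_space (UNIV :: 'a set)) \<rightarrow>\<^sub>M count_space UNIV"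
      using Suc by (intro measurable_component_singleton) auto
    have "(\<lambda>x. measure_pmf (srw_step E x)) \<in> count_space UNIV \<rightarrow>\<^sub>M subprob_algebra (count_space UNIV)"
      by (simp add: measure_pmf_in_subprob_algebra)
    from measurable_compose[OF comp this] show ?thesis
      using Suc by (simp add: srw_kernel_def[abs_def])
  qed
qed (simp add: srw_kernel_def measure_pmf.prob_space_axioms)

lemma sets_srw [measurable_cong]: "sets (srw E v) = sets (PiM UNIV (\<lambda>_. count_space UNIV))"
proof -
  interpret Ionescu_Tulcea "srw_kernel E v" "\<lambda>_. count_space UNIV"
    by (rule Ionescu_Tulcea_srw)
  show ?thesis
    by (simp add: srw_def)
qed

lemma space_srw [simp]: "space (srw E v) = UNIV"
  using sets_eq_imp_space_eq[OF sets_srw[of E v]] by (simp add: space_PiM)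

lemma emeasure_srw:
  "emeasure (srw E v) {\<omega>. \<forall>i\<le>n. \<omega> i = x i} =
     ennreal (if x 0 = v then \<Prod>i<n. pmf (srw_step E (x i)) (x (Suc i)) else 0)"
proof -
  let ?M = "\<lambda>_::nat. count_space (UNIV :: 'a set)"
  interpret Ionescu_Tulcea "srw_kernel E v" ?M
    by (rule Ionescu_Tulcea_srw)
  define X where "X k = PiE {0..<k} (\<lambda>i. {x i})" for k
  have X [measurable]: "X k \<in> sets (PiM {0..<k} ?M)" for k
    unfolding X_def by (intro sets_PiM_I_finite) auto
  have upd: "fun_upd \<omega> k y \<in> X (Suc k) \<longleftrightarrow> \<omega> \<in> X k \<and> y = x k"
    if "\<omega> \<in> space (PiM {0..<k} ?M)" for \<omega> k y
    using that by (auto simp: X_def PiE_iff space_PiM extensional_def)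
  have X0: "X 0 \<in> sets (PiM {} ?M)"
    using X[of 0] by simp
  have undef: "(\<lambda>_. undefined) \<in> space (PiM {0..<0} ?M)"
    by (simp add: space_PiM)
  have step: "emeasure (C 0 (Suc k) (\<lambda>_. undefined)) (X (Suc k)) =
      (\<integral>\<^sup>+\<omega>. indicator (X k) \<omega> * emeasure (srw_kernel E v k \<omega>) {x k} \<partial>C 0 k (\<lambda>_. undefined))" for k
  proof -
    have "emeasure (C 0 (Suc k) (\<lambda>_. undefined)) (X (Suc k)) =
        (\<integral>\<^sup>+\<omega>. emeasure (eP k \<omega>) (X (Suc k)) \<partial>C 0 k (\<lambda>_. undefined))"
      unfolding C.simps add_0
    proof (rule emeasure_bind[OF _ _ X])
      show "space (C 0 k (\<lambda>_. undefined)) \<noteq> {}"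
        by (rule prob_space.not_empty[OF prob_space_C[OF undef]])
      show "eP k \<in> C 0 k (\<lambda>_. undefined) \<rightarrow>\<^sub>M subprob_algebra (PiM {0..<Suc k} ?M)"
        using measurable_eP[of k] sets_C[OF undef, of k]
        by (subst measurable_cong_sets[OF _ refl, of _ "PiM {0..<k} ?M"]) simp_all
    qed
    also have "\<dots> = (\<integral>\<^sup>+\<omega>. indicator (X k) \<omega> * emeasure (srw_kernel E v k \<omega>) {x k}
        \<partial>C 0 k (\<lambda>_. undefined))"
    proof (intro nn_integral_cong)
      fix \<omega> assume "\<omega> \<in> space (C 0 k (\<lambda>_. undefined))"
      then have \<omega>: "\<omega> \<in> space (PiM {0..<k} ?M)"
        using space_C[OF undef, of k] by simp
      have "(\<lambda>y. fun_upd \<omega> k y) -` X (Suc k) = (if \<omega> \<in> X k then {x k} else {})"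
        using upd[OF \<omega>] by auto
      then show "emeasure (eP k \<omega>) (X (Suc k)) =
          indicator (X k) \<omega> * emeasure (srw_kernel E v k \<omega>) {x k}"
        by (subst emeasure_eP[OF \<omega> X]) auto
    qed
    finally show ?thesis .
  qed
  have C: "emeasure (C 0 (Suc k) (\<lambda>_. undefined)) (X (Suc k)) =
      ennreal (if x 0 = v then \<Prod>i<k. pmf (srw_step E (x i)) (x (Suc i)) else 0)" for k
  proof (induction k)
    case 0
    have "(\<lambda>_. undefined) \<in> X 0"
      by (simp add: X_def)
    then show ?case
      unfolding step
      by (simp only: C.simps, subst nn_integral_return[OF undef])
         (auto simp: srw_kernel_def emeasure_pmf_single X0
            intro!: borel_measurable_times_ennreal borel_measurable_indicator)
  next
    case (Suc k)
    have "emeasure (C 0 (Suc (Suc k)) (\<lambda>_. undefined)) (X (Suc (Suc k))) =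
        (\<integral>\<^sup>+\<omega>. ennreal (pmf (srw_step E (x k)) (x (Suc k))) * indicator (X (Suc k)) \<omega>
          \<partial>C 0 (Suc k) (\<lambda>_. undefined))"
      unfolding step[of "Suc k"]
      by (intro nn_integral_cong)
         (auto simp: srw_kernel_def emeasure_pmf_single X_def PiE_iff split: split_indicator)
    also have "\<dots> = ennreal (pmf (srw_step E (x k)) (x (Suc k))) *
        emeasure (C 0 (Suc k) (\<lambda>_. undefined)) (X (Suc k))"
      using sets_C[OF undef, of "Suc k"] by (subst nn_integral_cmult_indicator) auto
    finally show ?case
      unfolding Suc.IH by (simp add: ennreal_mult'[symmetric] prod_nonneg mult.commute)
  qed
  have "{\<omega>. \<forall>i\<le>n. \<omega> i = x i} = PF.emb UNIV {0..<Suc n} (X (Suc n))"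
    by (auto simp: prod_emb_def X_def PiE_iff space_PiM less_Suc_eq_le)
  then have "emeasure (srw E v) {\<omega>. \<forall>i\<le>n. \<omega> i = x i} = emeasure (CI {0..<Suc n}) (X (Suc n))"
    unfolding srw_def using lim[OF _ X[of "Suc n"]] by simp
  also have "\<dots> = emeasure (C 0 (Suc n) (\<lambda>_. undefined)) (X (Suc n))"
    using sets.sets_into_space[OF X[of "Suc n"]]
    by (subst emeasure_CI[OF order_refl X]) (simp add: prod_emb_id space_PiM del: C.simps)
  finally show ?thesis
    unfolding C .
qed

text \<open>The first time at which a trajectory is at \<open>w\<close>, infinite if it never is.\<close>

definition first_hit :: "'a \<Rightarrow> (nat \<Rightarrow> 'a) \<Rightarrow> ennreal" where
  "first_hit w \<omega> = (INF n\<in>{n. \<omega> n = w}. of_nat n)"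

definition hitting_time :: "'a set set \<Rightarrow> 'a \<Rightarrow> 'a \<Rightarrow> ennreal" where
  "hitting_time E v w = (\<integral>\<^sup>+\<omega>. first_hit w \<omega> \<partial>srw E v)"

lemma measurable_first_hit [measurable]: "first_hit w \<in> borel_measurable (srw E v)"
proof -
  have eq: "first_hit w = (\<lambda>\<omega>. INF n. if \<omega> n = w then of_nat n else \<top>)"
  proof (intro ext antisym)
    fix \<omega>
    show "first_hit w \<omega> \<le> (INF n. if \<omega> n = w then of_nat n else \<top>)"
      unfolding first_hit_def by (intro INF_greatest) (auto intro: INF_lower)
    show "(INF n. if \<omega> n = w then of_nat n else \<top>) \<le> first_hit w \<omega>"
      unfolding first_hit_def
    proof (intro INF_greatest)
      fix m assume "m \<in> {n. \<omega> n = w}"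
      then show "(INF n. if \<omega> n = w then of_nat n else (\<top> :: ennreal)) \<le> of_nat m"
        by (intro INF_lower2[of m]) auto
    qed
  qed
  have comp: "(\<lambda>\<omega>. \<omega> n) \<in> srw E v \<rightarrow>\<^sub>M count_space UNIV" for n
    using measurable_component_singleton[of n UNIV "\<lambda>_. count_space UNIV"]
    by (simp add: measurable_cong_sets[OF sets_srw refl])
  have "(\<lambda>\<omega>. if \<omega> n = w then of_nat n else (\<top> :: ennreal)) \<in> borel_measurable (srw E v)" for n
    using measurable_compose[OF comp, of "\<lambda>y. if y = w then of_nat n else (\<top> :: ennreal)" borel] by simp
  then show ?thesis
    unfolding eq by (intro borel_measurable_INF) auto
qed

definition cover_cost :: "'a set \<Rightarrow> 'a set set \<Rightarrow> 'a \<Rightarrow> ennreal" where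
  "cover_cost V E v = (\<Sum>w\<in>V. hitting_time E v w)"

definition reverse_cover_cost :: "'a set \<Rightarrow> 'a set set \<Rightarrow> 'a \<Rightarrow> ennreal" where
  "reverse_cover_cost V E v = (\<Sum>w\<in>V. hitting_time E w v)"

end

theory Submission
  imports Defs
begin

text \<open>Let \<open>D v\<close> be the sum of the distances from \<open>v\<close>. Of the neighbours of \<open>v\<close>, exactly one is closer
  to a given \<open>z \<noteq> v\<close> and all others are farther from it, so the function
  \<open>v \<mapsto> (n - 1) d(v, w) + D w - D v\<close> satisfies the one-step equations of the expected hitting time
  of \<open>w\<close>; being nonnegative and bounded, it equals the hitting time. Summation gives
  \<open>CC v = 2 W - D v\<close> and \<open>RC v = (2 n - 1) D v - 2 W\<close>.\<close>

section \<open>Hitting times as solutions of the one-step equations\<close>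

lemma prob_space_srw: "prob_space (srw E v)"
proof -
  interpret Ionescu_Tulcea "srw_kernel E v" "\<lambda>_. count_space UNIV"
    by (rule Ionescu_Tulcea_srw)
  show ?thesis
    unfolding srw_def
  \<comment> \<open>A pushforward keeps the total mass, so it suffices to look at the marginal on
    the empty index set, which belongs to a projective family of probability measures.\<close>
  proof (rule prob_space_distrD)
    show "(\<lambda>\<omega>. restrict \<omega> {}) \<in> PF.lim \<rightarrow>\<^sub>M PiM {} (\<lambda>_. count_space UNIV)"
      by (intro measurable_restrict) auto
    show "prob_space (distr PF.lim (PiM {} (\<lambda>_. count_space UNIV)) (\<lambda>\<omega>. restrict \<omega> {}))"
      unfolding distr_lim[OF finite.emptyI] by (rule PF.prob_space_P) auto
  qed
qed

lemma measurable_srw_component [measurable]: "(\<lambda>\<omega>. \<omega> n) \<in> srw E v \<rightarrow>\<^sub>M count_space UNIV"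
  using measurable_component_singleton[of n UNIV "\<lambda>_. count_space UNIV"]
  by (simp add: measurable_cong_sets[OF sets_srw refl])

lemma sets_srw_Collect: "Measurable.pred (srw E v) P \<Longrightarrow> {\<omega>. P \<omega>} \<in> sets (srw E v)"
  by (simp add: pred_def)

lemma AE_srw_start: "AE \<omega> in srw E v. \<omega> 0 = v"
proof -
  interpret prob_space "srw E v" by (rule prob_space_srw)
  have "emeasure (srw E v) {\<omega>. \<omega> 0 = v} = 1"
    using emeasure_srw[of E v 0 "\<lambda>_. v"] by simp
  moreover have "{\<omega>. \<omega> 0 = v} \<in> sets (srw E v)"
    by (rule sets_srw_Collect) measurable
  ultimately show ?thesis
    using prob_Collect_eq_1[of "\<lambda>\<omega>. \<omega> 0 = v"] by (simp add: emeasure_eq_measure)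
qed

section \<open>Probabilities of avoiding the target\<close>

abbreviation neighbours :: "'a set set \<Rightarrow> 'a \<Rightarrow> 'a set" where
  "neighbours E x \<equiv> {y. {x, y} \<in> E}"

text \<open>Intended as the probability that the walk from \<open>x\<close> is not at
  \<open>w\<close> at any of the times 0 to \<open>n\<close>, obtained by conditioning on the first
  step. \<open>emeasure_srw_cylinder_avoid\<close> ties it to \<open>srw\<close>.\<close>

primrec avoid_prob :: "'a set set \<Rightarrow> 'a \<Rightarrow> nat \<Rightarrow> 'a \<Rightarrow> real" where
  "avoid_prob E w 0 x = (if x = w then 0 else 1)"
| "avoid_prob E w (Suc n) x = (if x = w then 0
     else (\<Sum>y\<in>neighbours E x. avoid_prob E w n y) / card (neighbours E x))"

lemma avoid_prob_nonneg: "avoid_prob E w n x \<ge> 0"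
  by (induction n arbitrary: x) (auto intro!: sum_nonneg divide_nonneg_nonneg)

lemma avoid_prob_target [simp]: "avoid_prob E w n w = 0"
  by (cases n) auto

lemma emeasure_srw_cylinder_step:
  assumes "finite (neighbours E (x m))" "y \<in> neighbours E (x m)"
  shows "emeasure (srw E v) {\<omega>. (\<forall>i\<le>m. \<omega> i = x i) \<and> \<omega> (Suc m) = y} =
    emeasure (srw E v) {\<omega>. \<forall>i\<le>m. \<omega> i = x i} * ennreal (1 / card (neighbours E (x m)))"
proof -
  have eq: "{\<omega>. (\<forall>i\<le>m. \<omega> i = x i) \<and> \<omega> (Suc m) = y} = {\<omega>. \<forall>i\<le>Suc m. \<omega> i = (x(Suc m := y)) i}"
    by (auto simp: le_Suc_eq)
  \<comment> \<open>\<open>pmf_of_set\<close> is specified only for finite nonempty sets;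
    \<open>y\<close> witnesses nonemptiness.\<close>
  have "pmf (srw_step E (x m)) y = 1 / card (neighbours E (x m))"
    using assms unfolding srw_step_def by (subst pmf_of_set) auto
  then show ?thesis
    unfolding eq emeasure_srw by (auto simp: prod_nonneg simp flip: ennreal_mult)
qed

text \<open>This is the Markov property for avoidance events. The induction on \<open>n\<close>
  keeps the history arbitrary: splitting on the next vertex turns a history up to time
  \<open>m\<close> into histories up to time \<open>Suc m\<close>, so trajectories never have to be
  shifted.\<close>

lemma emeasure_srw_cylinder_avoid:
  assumes V: "finite V"
    and nb: "\<And>x. x \<in> V \<Longrightarrow> x \<noteq> w \<Longrightarrow> neighbours E x \<subseteq> V \<and> neighbours E x \<noteq> {}"
    and "x m \<in> V"
  shows "emeasure (srw E v) {\<omega>. (\<forall>i\<le>m. \<omega> i = x i) \<and> (\<forall>i\<le>n. \<omega> (m + i) \<noteq> w)} =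
    emeasure (srw E v) {\<omega>. \<forall>i\<le>m. \<omega> i = x i} * ennreal (avoid_prob E w n (x m))"
  using \<open>x m \<in> V\<close>
proof (induction n arbitrary: m x)
  case 0
  show ?case
  proof (cases "x m = w")
    case True
    then have "{\<omega>. (\<forall>i\<le>m. \<omega> i = x i) \<and> (\<forall>i\<le>0. \<omega> (m + i) \<noteq> w)} = {}" by auto
    with True show ?thesis by (simp only: emeasure_empty avoid_prob_target) simp
  next
    case False
    then have "{\<omega>. (\<forall>i\<le>m. \<omega> i = x i) \<and> (\<forall>i\<le>0. \<omega> (m + i) \<noteq> w)} = {\<omega>. \<forall>i\<le>m. \<omega> i = x i}"
      by auto
    with False show ?thesis by simp
  qed
next
  case (Suc n)
  show ?case
  proof (cases "x m = w")
    case True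
    then have "{\<omega>. (\<forall>i\<le>m. \<omega> i = x i) \<and> (\<forall>i\<le>Suc n. \<omega> (m + i) \<noteq> w)} = {}"
      by (auto dest: spec[of _ 0])
    with True show ?thesis by (simp only: emeasure_empty avoid_prob_target) simp
  next
    case False
    define N where "N = neighbours E (x m)"
    define M where "M = srw E v"
    define C where "C = {\<omega>. \<forall>i\<le>m. \<omega> i = x i}"
    define A where "A y = {\<omega>. (\<forall>i\<le>m. \<omega> i = x i) \<and> \<omega> (Suc m) = y}" for y
    \<comment> \<open>The history extended by \<open>y\<close>, written as a function update so that
      the induction hypothesis applies at time \<open>Suc m\<close>.\<close>
    define B where "B y = {\<omega>. (\<forall>i\<le>Suc m. \<omega> i = (x(Suc m := y)) i)
      \<and> (\<forall>i\<le>n. \<omega> (Suc m + i) \<noteq> w)}" for y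
    define D where "D = {\<omega>. (\<forall>i\<le>m. \<omega> i = x i) \<and> (\<forall>i\<le>Suc n. \<omega> (m + i) \<noteq> w)}"
    have N: "finite N" "N \<subseteq> V" "N \<noteq> {}"
      using nb[OF Suc.prems False] V by (auto simp: N_def intro: finite_subset)
    have meas: "C \<in> sets M" "A y \<in> sets M" "B y \<in> sets M" "D \<in> sets M" for y
      unfolding C_def A_def B_def D_def M_def by (rule sets_srw_Collect; measurable)+
    have A_eq: "A y = {\<omega>. \<forall>i\<le>Suc m. \<omega> i = (x(Suc m := y)) i}" for y
      by (auto simp: A_def le_Suc_eq)
    have A: "emeasure M (A y) = emeasure M C * ennreal (1 / card N)" if "y \<in> N" for y
      using emeasure_srw_cylinder_step[where E = E and x = x and m = m and y = y and v = v] N that 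
      by (simp add: A_def C_def M_def N_def)
    have B: "emeasure M (B y) = emeasure M C * ennreal (avoid_prob E w n y / card N)"
      if "y \<in> N" for y
    proof -
      have "emeasure M (B y) = emeasure M (A y) * ennreal (avoid_prob E w n y)"
        using Suc.IH[of "x(Suc m := y)" "Suc m"] that N
        unfolding M_def B_def A_eq fun_upd_same by blast
      then show ?thesis
        using A[OF that] by (simp add: mult.assoc ennreal_mult'[symmetric])
    qed
    have "emeasure M (\<Union>y\<in>N. A y) = (\<Sum>y\<in>N. emeasure M (A y))"
      using N meas by (intro sum_emeasure[symmetric]) (auto simp: disjoint_family_on_def A_def)
    also have "\<dots> = emeasure M C * (of_nat (card N) * ennreal (1 / card N))"
      using A by (simp add: mult_ac)
    also have "of_nat (card N) * ennreal (1 / card N) = 1"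
      using N by (simp add: ennreal_of_nat_eq_real_of_nat ennreal_mult'[symmetric])
    finally have AU: "emeasure M (\<Union>y\<in>N. A y) = emeasure M C"
      by simp
    \<comment> \<open>The one-step extensions inside \<open>N\<close> already carry the full mass of
      \<open>C\<close>; since that mass is finite, leaving \<open>x m\<close> for a non-neighbour is
      a null event.\<close>
    have "emeasure M (C - (\<Union>y\<in>N. A y)) = emeasure M C - emeasure M (\<Union>y\<in>N. A y)"
    proof (rule emeasure_Diff)
      show "emeasure M (\<Union>y\<in>N. A y) \<noteq> \<infinity>"
        unfolding AU by (simp add: M_def C_def emeasure_srw)
    qed (use meas N in \<open>auto simp: A_def C_def\<close>)
    also have "\<dots> = 0"
      unfolding AU by (simp add: M_def C_def emeasure_srw)
    finally have null: "C - (\<Union>y\<in>N. A y) \<in> null_sets M"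
      using meas N by (intro null_setsI sets.Diff sets.finite_UN)
    have D_iff: "\<omega> \<in> D \<longleftrightarrow> \<omega> \<in> C \<and> (\<forall>i\<le>n. \<omega> (Suc m + i) \<noteq> w)" for \<omega>
    proof -
      have "(\<forall>i\<le>Suc n. \<omega> (m + i) \<noteq> w) \<longleftrightarrow> \<omega> m \<noteq> w \<and> (\<forall>i\<le>n. \<omega> (Suc m + i) \<noteq> w)"
        by (simp add: less_Suc_eq_le[symmetric] All_less_Suc2)
      with False show ?thesis by (auto simp: D_def C_def)
    qed
    have B_iff: "\<omega> \<in> B y \<longleftrightarrow> \<omega> \<in> A y \<and> (\<forall>i\<le>n. \<omega> (Suc m + i) \<noteq> w)" for \<omega> y
      unfolding B_def A_eq by auto
    have "emeasure M D = emeasure M (\<Union>y\<in>N. B y)"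
    proof (rule emeasure_eq_AE)
      show "AE \<omega> in M. \<omega> \<in> D \<longleftrightarrow> \<omega> \<in> (\<Union>y\<in>N. B y)"
        using AE_not_in[OF null] by eventually_elim (auto simp: D_iff B_iff, auto simp: A_def C_def)
    qed (use meas N in auto)
    also have "\<dots> = (\<Sum>y\<in>N. emeasure M (B y))"
      using N meas
      by (intro sum_emeasure[symmetric]) (auto simp: disjoint_family_on_def B_iff, auto simp: A_def)
    also have "\<dots> = emeasure M C * (\<Sum>y\<in>N. ennreal (avoid_prob E w n y / card N))"
      by (simp add: B sum_distrib_left)
    also have "(\<Sum>y\<in>N. ennreal (avoid_prob E w n y / card N)) = ennreal (avoid_prob E w (Suc n) (x m))"
      using False by (subst sum_ennreal) (auto simp: N_def avoid_prob_nonneg sum_divide_distrib)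
    finally show ?thesis
      by (simp only: D_def C_def M_def)
  qed
qed

text \<open>Tail-sum formula: a time in the naturals is the number of \<open>n\<close> strictly
  below it. If \<open>w\<close> is never hit, the infimum over the empty set and the series of ones
  are both infinite.\<close>

lemma first_hit_eq_suminf:
  "first_hit w \<omega> = (\<Sum>n. indicator {\<omega>. \<forall>i\<le>n. \<omega> i \<noteq> w} \<omega>)"
proof (cases "\<exists>k. \<omega> k = w")
  case True
  define k where "k = (LEAST k. \<omega> k = w)"
  have k: "\<omega> k = w" "\<And>i. \<omega> i = w \<Longrightarrow> k \<le> i"
    using True unfolding k_def by (auto intro: LeastI_ex Least_le)
  have "first_hit w \<omega> = of_nat k"
    unfolding first_hit_def
    by (intro antisym INF_lower2[of k] INF_greatest) (auto simp: k)
  moreover have "(\<forall>i\<le>n. \<omega> i \<noteq> w) \<longleftrightarrow> n < k" for n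
    using k by (metis le_less_trans not_less)
  then have "(\<Sum>n. indicator {\<omega>. \<forall>i\<le>n. \<omega> i \<noteq> w} \<omega> :: ennreal) = (\<Sum>n. indicator {..<k} n)"
    by (intro suminf_cong) (auto split: split_indicator)
  moreover have "(\<Sum>n. indicator {..<k} n :: ennreal) = (\<Sum>n<k. indicator {..<k} n)"
    by (intro suminf_finite) auto
  ultimately show ?thesis by simp
next
  case False
  then have "first_hit w \<omega> = \<top>" by (simp add: first_hit_def)
  moreover have "(\<Sum>n. 1 :: ennreal) = \<top>"
    by (simp add: suminf_eq_SUP ennreal_SUP_of_nat_eq_top)
  ultimately show ?thesis using False by simp
qed

lemma hitting_time_eq_suminf_avoid_prob:
  assumes V: "finite V"
    and nb: "\<And>x. x \<in> V \<Longrightarrow> x \<noteq> w \<Longrightarrow> neighbours E x \<subseteq> V \<and> neighbours E x \<noteq> {}"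
    and "v \<in> V"
  shows "hitting_time E v w = (\<Sum>n. ennreal (avoid_prob E w n v))"
proof -
  have meas: "{\<omega>. \<forall>i\<le>n. \<omega> i \<noteq> w} \<in> sets (srw E v)" for n
    by (rule sets_srw_Collect) measurable
  have "hitting_time E v w = (\<Sum>n. emeasure (srw E v) {\<omega>. \<forall>i\<le>n. \<omega> i \<noteq> w})"
    unfolding hitting_time_def first_hit_eq_suminf
    using meas by (subst nn_integral_suminf) auto
  also have "\<dots> = (\<Sum>n. ennreal (avoid_prob E w n v))"
  proof (rule suminf_cong)
    fix n
    \<comment> \<open>Almost surely the walk starts at \<open>v\<close>, so the event may be
      intersected with the history consisting of time 0 only.\<close>
    have "emeasure (srw E v) {\<omega>. \<forall>i\<le>n. \<omega> i \<noteq> w} =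
        emeasure (srw E v) {\<omega>. (\<forall>i\<le>0. \<omega> i = v) \<and> (\<forall>i\<le>n. \<omega> (0 + i) \<noteq> w)}"
    proof (rule emeasure_eq_AE)
      show "AE \<omega> in srw E v. \<omega> \<in> {\<omega>. \<forall>i\<le>n. \<omega> i \<noteq> w} \<longleftrightarrow>
          \<omega> \<in> {\<omega>. (\<forall>i\<le>0. \<omega> i = v) \<and> (\<forall>i\<le>n. \<omega> (0 + i) \<noteq> w)}"
        using AE_srw_start[of v E] by eventually_elim auto
    qed (rule sets_srw_Collect; measurable)+
    also have "\<dots> = emeasure (srw E v) {\<omega>. \<forall>i\<le>0. \<omega> i = v} * ennreal (avoid_prob E w n v)"
      using assms by (intro emeasure_srw_cylinder_avoid[where x = "\<lambda>_. v" and m = 0]) auto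
    also have "emeasure (srw E v) {\<omega>. \<forall>i\<le>0. \<omega> i = v} = 1"
      using emeasure_srw[of E v 0 "\<lambda>_. v"] by simp
    finally show "emeasure (srw E v) {\<omega>. \<forall>i\<le>n. \<omega> i \<noteq> w} = ennreal (avoid_prob E w n v)"
      by simp
  qed
  finally show ?thesis .
qed

text \<open>The difference between \<open>g\<close> and the partial sums of \<open>avoid_prob\<close> is \<open>g\<close> averaged over the
  walk killed at \<open>w\<close>, hence at most a constant times \<open>avoid_prob\<close>, which tends to zero because its
  partial sums are bounded by \<open>g\<close>.\<close>

lemma avoid_prob_sums:
  fixes g :: "'a \<Rightarrow> real"
  assumes V: "finite V"
    and nb: "\<And>x. x \<in> V \<Longrightarrow> x \<noteq> w \<Longrightarrow> neighbours E x \<subseteq> V \<and> neighbours E x \<noteq> {}"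
    and g_nonneg: "\<And>x. x \<in> V \<Longrightarrow> g x \<ge> 0"
    and g_target: "g w = 0"
    and g_step: "\<And>x. x \<in> V \<Longrightarrow> x \<noteq> w \<Longrightarrow>
      g x = 1 + (\<Sum>y\<in>neighbours E x. g y) / card (neighbours E x)"
    and "v \<in> V"
  shows "(\<lambda>n. avoid_prob E w n v) sums g v"
proof -
  \<comment> \<open>Any upper bound for \<open>g\<close> on \<open>V\<close> serves; the sum is one
    because \<open>g\<close> is nonnegative there.\<close>
  define c where "c = (\<Sum>x\<in>V. g x)"
  have c: "g x \<le> c" if "x \<in> V" for x
    unfolding c_def using that V g_nonneg by (intro member_le_sum) auto
  have rem: "0 \<le> g x - (\<Sum>k<n. avoid_prob E w k x) \<and>
      g x - (\<Sum>k<n. avoid_prob E w k x) \<le> c * avoid_prob E w n x" if "x \<in> V" for x n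
    using that
  proof (induction n arbitrary: x)
    case 0
    then show ?case using g_target g_nonneg c by auto
  next
    case (Suc n)
    show ?case
    proof (cases "x = w")
      case True
      then show ?thesis using g_target by simp
    next
      case False
      define N where "N = neighbours E x"
      have N: "N \<subseteq> V" using nb[OF Suc.prems False] by (simp add: N_def)
      define r where "r y = g y - (\<Sum>k<n. avoid_prob E w k y)" for y
      \<comment> \<open>Splitting off the summand for index 0, which is 1 because \<open>x\<close>
        differs from \<open>w\<close>, cancels the 1 in the one-step equation.\<close>
      have "g x - (\<Sum>k<Suc n. avoid_prob E w k x) =
          (\<Sum>y\<in>N. g y) / card N - (\<Sum>k<n. (\<Sum>y\<in>N. avoid_prob E w k y) / card N)"
        using g_step[OF Suc.prems False] False
        by (simp add: sum.lessThan_Suc_shift N_def del: sum.lessThan_Suc)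
      also have "\<dots> = ((\<Sum>y\<in>N. g y) - (\<Sum>k<n. \<Sum>y\<in>N. avoid_prob E w k y)) / card N"
        by (simp add: sum_divide_distrib diff_divide_distrib)
      also have "(\<Sum>k<n. \<Sum>y\<in>N. avoid_prob E w k y) = (\<Sum>y\<in>N. \<Sum>k<n. avoid_prob E w k y)"
        by (rule sum.swap)
      also have "(\<Sum>y\<in>N. g y) - \<dots> = (\<Sum>y\<in>N. r y)"
        by (simp add: r_def sum_subtractf)
      finally have eq: "g x - (\<Sum>k<Suc n. avoid_prob E w k x) = (\<Sum>y\<in>N. r y) / card N" .
      have "(\<Sum>y\<in>N. r y) \<le> (\<Sum>y\<in>N. c * avoid_prob E w n y)"
        using Suc.IH N by (intro sum_mono) (auto simp: r_def)
      then have "(\<Sum>y\<in>N. r y) / card N \<le> (\<Sum>y\<in>N. c * avoid_prob E w n y) / card N"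
        by (rule divide_right_mono) simp
      also have "\<dots> = c * avoid_prob E w (Suc n) x"
        using False by (simp add: sum_distrib_left N_def)
      finally have "(\<Sum>y\<in>N. r y) / card N \<le> c * avoid_prob E w (Suc n) x" .
      moreover have "0 \<le> (\<Sum>y\<in>N. r y) / card N"
        using Suc.IH N by (intro divide_nonneg_nonneg sum_nonneg) (auto simp: r_def)
      ultimately show ?thesis unfolding eq by simp
    qed
  qed
  have "summable (\<lambda>n. avoid_prob E w n v)"
  proof (rule summableI_nonneg_bounded)
    show "(\<Sum>k<n. avoid_prob E w k v) \<le> g v" for n
      using rem[OF \<open>v \<in> V\<close>, of n] by simp
  qed (rule avoid_prob_nonneg)
  then have lim: "(\<lambda>n. c * avoid_prob E w n v) \<longlonglongrightarrow> c * 0"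
    by (intro tendsto_mult tendsto_const summable_LIMSEQ_zero)
  have "(\<lambda>n. g v - (\<Sum>k<n. avoid_prob E w k v)) \<longlonglongrightarrow> 0"
  proof (rule real_tendsto_sandwich[OF _ _ tendsto_const])
    show "(\<lambda>n. c * avoid_prob E w n v) \<longlonglongrightarrow> 0"
      using lim by simp
  qed (use rem[OF \<open>v \<in> V\<close>] in auto)
  from tendsto_diff[OF tendsto_const[of "g v"] this] show ?thesis
    by (simp add: sums_def)
qed

text \<open>Allows hitting times to be found by guessing a nonnegative solution of the one-step
  equations and verifying it.\<close>

lemma hitting_time_eqI:
  fixes g :: "'a \<Rightarrow> real"
  assumes "finite V"
    and "\<And>x. x \<in> V \<Longrightarrow> x \<noteq> w \<Longrightarrow> neighbours E x \<subseteq> V \<and> neighbours E x \<noteq> {}"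
    and "\<And>x. x \<in> V \<Longrightarrow> g x \<ge> 0"
    and "g w = 0"
    and "\<And>x. x \<in> V \<Longrightarrow> x \<noteq> w \<Longrightarrow>
      g x = 1 + (\<Sum>y\<in>neighbours E x. g y) / card (neighbours E x)"
    and "v \<in> V"
  shows "hitting_time E v w = ennreal (g v)"
proof -
  have "(\<lambda>n. avoid_prob E w n v) sums g v"
    using assms by (rule avoid_prob_sums)
  then have "(\<Sum>n. ennreal (avoid_prob E w n v)) = ennreal (g v)"
    by (intro suminf_ennreal_eq avoid_prob_nonneg)
  moreover have "hitting_time E v w = (\<Sum>n. ennreal (avoid_prob E w n v))"
    using assms(1,2,6) by (rule hitting_time_eq_suminf_avoid_prob)
  ultimately show ?thesis by simp
qed


section \<open>Distances in trees\<close>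

lemma walk_between_edge:
  assumes "walk_between V E u xs v" "x \<in> V" "{x, u} \<in> E"
  shows "walk_between V E x (x # xs) v"
  using assms by (cases xs) (auto simp: walk_between_def)

lemma walk_between_append:
  assumes "walk_between V E u xs v" "walk_between V E v ys w"
  shows "walk_between V E u (xs @ tl ys) w"
  using assms by (cases ys; cases "tl ys")
    (auto simp: walk_between_def successively_append_iff)

lemma walk_between_suffix:
  assumes "walk_between V E u (as @ x # bs) v"
  shows "walk_between V E x (x # bs) v"
  using assms by (auto simp: walk_between_def successively_append_iff)

lemma walk_between_prefix:
  assumes "walk_between V E u (as @ x # bs) v"
  shows "walk_between V E u (as @ [x]) x"
  using walk_between_rev[OF walk_between_suffix[of V E v "rev bs" x "rev as" u]]
    walk_between_rev[OF assms] by simp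

text \<open>Cutting out the segment between two visits to the same vertex leaves a strictly shorter
  walk with the same ends.\<close>

lemma walk_between_imp_distinct:
  assumes "walk_between V E u xs v"
  shows "\<exists>ys. walk_between V E u ys v \<and> distinct ys"
  using assms
proof (induction "length xs" arbitrary: xs rule: less_induct)
  case less
  show ?case
  proof (cases "distinct xs")
    case False
    then obtain as bs cs y where xs: "xs = as @ [y] @ bs @ [y] @ cs"
      using not_distinct_decomp by blast
    have "walk_between V E u (as @ y # cs) v"
      using walk_between_append[OF walk_between_prefix[of V E u as y "bs @ y # cs" v]
          walk_between_suffix[of V E u "as @ y # bs" y cs v]] less.prems
      by (simp add: xs)
    moreover have "length (as @ y # cs) < length xs"
      by (simp add: xs)
    ultimately show ?thesis by (intro less.hyps)
  qed (use less.prems in auto)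
qed

lemma gdist_le:
  assumes "walk_between V E u xs v"
  shows "gdist V E u v \<le> length xs - 1"
  using assms unfolding gdist_def
  by (intro Least_le exI[of _ xs]) (auto simp: walk_between_def)

lemma gdist_walk:
  assumes "walk_between V E u xs v"
  obtains ys where "walk_between V E u ys v" "length ys = Suc (gdist V E u v)"
proof -
  have "\<exists>k ys. walk_between V E u ys v \<and> length ys = Suc k"
    using assms by (intro exI[of _ "length xs - 1"] exI[of _ xs]) (auto simp: walk_between_def)
  from LeastI_ex[OF this] show ?thesis
    using that unfolding gdist_def by blast
qed

lemma gdist_self: "u \<in> V \<Longrightarrow> gdist V E u u = 0"
  using gdist_le[of V E u "[u]" u] by (simp add: walk_between_def)

section \<open>Distances from the neighbours of a vertex in a tree\<close>

locale finite_tree =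
  fixes V :: "'a set" and E :: "'a set set"
  assumes tree: "is_tree V E"
begin

abbreviation d :: "'a \<Rightarrow> 'a \<Rightarrow> nat" where "d \<equiv> gdist V E"

abbreviation N :: "'a \<Rightarrow> 'a set" where "N \<equiv> neighbours E"

lemma finite_V: "finite V"
  using tree by (simp add: is_tree_def fin_graph_def)

lemma V_nonempty: "V \<noteq> {}"
  using tree by (simp add: is_tree_def connected_graph_def)

lemma edge_in_V: "{x, y} \<in> E \<Longrightarrow> x \<in> V \<and> y \<in> V"
  using tree by (auto simp: is_tree_def fin_graph_def)

lemma no_loop: "{x, x} \<notin> E"
  using tree by (force simp: is_tree_def fin_graph_def)

lemma finite_N: "finite (N x)"
  using finite_V by (rule finite_subset[rotated]) (auto dest: edge_in_V)

lemma shortest_walk: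
  assumes "u \<in> V" "v \<in> V"
  obtains xs where "walk_between V E u xs v" "length xs = Suc (d u v)"
  using assms tree gdist_walk[of V E u _ v] by (metis is_tree_def connected_graph_def)

lemma d_triangle:
  assumes "u \<in> V" "v \<in> V" "w \<in> V"
  shows "d u w \<le> d u v + d v w"
proof -
  obtain xs ys where "walk_between V E u xs v" "length xs = Suc (d u v)"
    "walk_between V E v ys w" "length ys = Suc (d v w)"
    using assms shortest_walk by metis
  with gdist_le[OF walk_between_append[of V E u xs v ys w]] show ?thesis by simp
qed

lemma d_edge_le:
  assumes "{x, y} \<in> E" "z \<in> V"
  shows "d x z \<le> Suc (d y z)"
proof -
  obtain xs where xs: "walk_between V E y xs z" "length xs = Suc (d y z)"
    using assms edge_in_V shortest_walk by metis
  have "walk_between V E x (x # xs) z"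
    using xs assms edge_in_V by (intro walk_between_edge) auto
  from gdist_le[OF this] xs show ?thesis by simp
qed

text \<open>The second vertex of a shortest walk is closer by at least one, and an edge changes the
  distance by at most one.\<close>

lemma closer_neighbour:
  assumes "v \<in> V" "z \<in> V" "v \<noteq> z"
  obtains y where "{v, y} \<in> E" "d v z = Suc (d y z)"
proof -
  obtain xs where xs: "walk_between V E v xs z" "length xs = Suc (d v z)"
    using assms shortest_walk by metis
  obtain y ys where eq: "xs = v # y # ys"
    using xs \<open>v \<noteq> z\<close> by (cases xs; cases "tl xs") (auto simp: walk_between_def)
  have edge: "{v, y} \<in> E" using xs by (auto simp: eq walk_between_def)
  have "walk_between V E y (y # ys) z"
    using xs(1) walk_between_suffix[of V E v "[v]" y ys z] by (simp add: eq)
  from gdist_le[OF this] xs have "Suc (d y z) \<le> d v z" by (simp add: eq)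
  with d_edge_le[OF edge \<open>z \<in> V\<close>] that edge show ?thesis by simp
qed

text \<open>If a shortest walk from \<open>y\<close> to \<open>z\<close> passed through
  \<open>v\<close>, its part after leaving \<open>y\<close> would contain a walk from
  \<open>v\<close> to \<open>z\<close>, forcing \<open>d y z > d v z\<close>. Deletion of
  \<open>v\<close> is expressed by shrinking the vertex set.\<close>

lemma shortest_walk_avoids:
  assumes "y \<in> V" "z \<in> V" "y \<noteq> v" "d y z \<le> d v z"
  obtains xs where "walk_between (V - {v}) E y xs z"
proof -
  obtain xs where xs: "walk_between V E y xs z" "length xs = Suc (d y z)"
    using assms shortest_walk by metis
  have "v \<notin> set xs"
  proof
    assume "v \<in> set xs"
    then obtain as bs where eq: "xs = as @ v # bs" by (meson split_list)
    with xs assms have "as \<noteq> []" by (auto simp: walk_between_def)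
    moreover have "d v z \<le> length bs"
      using gdist_le[OF walk_between_suffix[of V E y as v bs z]] xs eq by simp
    ultimately show False using xs assms by (cases as) (auto simp: eq)
  qed
  with xs that show ?thesis by (auto simp: walk_between_def)
qed

text \<open>Two such neighbours would both reach \<open>z\<close> without using \<open>v\<close>,
  hence be joined by a path avoiding \<open>v\<close>, and \<open>v\<close> would close this path to
  a cycle. The non-strict bounds also exclude neighbours at the same distance as
  \<open>v\<close>.\<close>

lemma closer_neighbour_unique:
  assumes "{v, y1} \<in> E" "{v, y2} \<in> E" "z \<in> V" "d y1 z \<le> d v z" "d y2 z \<le> d v z"
  shows "y1 = y2"
proof (rule ccontr)
  assume "y1 \<noteq> y2"
  have V: "v \<in> V" "y1 \<in> V" "y2 \<in> V" "y1 \<noteq> v" "y2 \<noteq> v"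
    using assms edge_in_V no_loop by auto
  obtain xs where xs: "walk_between (V - {v}) E y1 xs z"
    using shortest_walk_avoids[OF V(2) assms(3) V(4) assms(4)] .
  obtain ys where ys: "walk_between (V - {v}) E y2 ys z"
    using shortest_walk_avoids[OF V(3) assms(3) V(5) assms(5)] .
  obtain p where p: "walk_between (V - {v}) E y1 p y2" "distinct p"
    using walk_between_imp_distinct[OF walk_between_append[OF xs walk_between_rev[OF ys]]] by blast
  \<comment> \<open>Together with \<open>v\<close> this gives the three vertices that a cycle must
    have.\<close>
  have "length p \<ge> 2"
    using p \<open>y1 \<noteq> y2\<close> by (cases p; cases "tl p") (auto simp: walk_between_def)
  moreover have "successively (\<lambda>x y. {x, y} \<in> E) (v # p)"
    using p assms by (cases p) (auto simp: walk_between_def)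
  ultimately have "is_cycle E (v # p)"
    using p assms by (auto simp: is_cycle_def walk_between_def insert_commute)
  then show False using tree by (auto simp: is_tree_def)
qed

text \<open>For \<open>v \<noteq> z\<close> one neighbour is at distance \<open>d v z - 1\<close>
  and all others at \<open>d v z + 1\<close>, whence the correction 2. For \<open>v = z\<close> all
  neighbours are at distance 1 and nothing is corrected.\<close>

lemma sum_d_neighbours:
  assumes "v \<in> V" "z \<in> V"
  shows "(\<Sum>y\<in>N v. real (d y z)) = card (N v) * (real (d v z) + 1) - (if v = z then 0 else 2)"
proof (cases "v = z")
  case True
  have "d y z = 1" if "y \<in> N v" for y
  proof -
    have "d y v \<le> Suc (d v v)"
      using that assms by (intro d_edge_le) (auto simp: insert_commute)
    moreover have "d y v \<noteq> 0"
    proof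
      assume "d y v = 0"
      moreover have "y \<in> V" "y \<noteq> v" using that edge_in_V no_loop by auto
      ultimately show False using closer_neighbour[of y v] assms by auto
    qed
    ultimately show ?thesis using True assms by (simp add: gdist_self)
  qed
  then show ?thesis using True assms by (simp add: gdist_self)
next
  case False
  obtain p where p: "{v, p} \<in> E" "d v z = Suc (d p z)"
    using closer_neighbour[OF assms False] .
  have far: "d y z = Suc (d v z)" if "y \<in> N v - {p}" for y
  proof -
    have "d y z \<le> Suc (d v z)"
      using that assms by (intro d_edge_le) (auto simp: insert_commute)
    moreover have "\<not> d y z \<le> d v z"
      using closer_neighbour_unique[of v y p z] that p assms by auto
    ultimately show ?thesis by simp
  qed
  have "card (N v) \<ge> 1"
    using p finite_N[of v] by (simp add: Suc_le_eq card_gt_0_iff) blast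
  moreover have "(\<Sum>y\<in>N v. real (d y z)) = real (d p z) + (\<Sum>y\<in>N v - {p}. real (d y z))"
    using p finite_N by (intro sum.remove) auto
  moreover have "(\<Sum>y\<in>N v - {p}. real (d y z)) = (card (N v) - 1) * (real (d v z) + 1)"
    using far p finite_N by (simp add: card_Diff_singleton)
  ultimately show ?thesis using p False by (simp add: of_nat_diff algebra_simps)
qed

section \<open>Sums of distances from a vertex\<close>

definition transmission :: "'a \<Rightarrow> real" where
  "transmission v = (\<Sum>z\<in>V. real (d v z))"

text \<open>Summing \<open>sum_d_neighbours\<close> over \<open>z\<close> collects the correction 2
  once for each vertex other than \<open>v\<close>.\<close>

lemma sum_transmission_neighbours:
  assumes "v \<in> V"
  shows "(\<Sum>y\<in>N v. transmission y) =
    card (N v) * (transmission v + card V) - 2 * (real (card V) - 1)"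
proof -
  have "card V \<ge> 1"
    using finite_V V_nonempty by (simp add: Suc_le_eq card_gt_0_iff)
  have "(\<Sum>y\<in>N v. transmission y) = (\<Sum>z\<in>V. \<Sum>y\<in>N v. real (d y z))"
    unfolding transmission_def by (rule sum.swap)
  also have "\<dots> = (\<Sum>z\<in>V. card (N v) * (real (d v z) + 1) - (if v = z then 0 else 2))"
    using assms by (intro sum.cong) (auto simp: sum_d_neighbours)
  also have "\<dots> = card (N v) * (transmission v + card V) - (\<Sum>z\<in>V. if v = z then 0 else 2)"
    by (simp add: sum_subtractf sum_distrib_left[symmetric] sum.distrib transmission_def)
  also have "(\<Sum>z\<in>V. if v = z then 0 else 2::real) = (\<Sum>z\<in>V - {v}. 2)"
    using finite_V assms by (subst sum.remove[of _ v]) (auto intro!: sum.cong simp del: sum_constant split: if_splits)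
  also have "\<dots> = 2 * (real (card V) - 1)"
    using assms \<open>card V \<ge> 1\<close> finite_V by (simp add: card_Diff_singleton of_nat_diff)
  finally show ?thesis .
qed

text \<open>The triangle inequality is summed over \<open>z \<noteq> v\<close> only, so the factor
  is \<open>card V - 1\<close> and not \<open>card V\<close>. This is exactly the nonnegativity of
  the hitting time formula.\<close>

lemma transmission_le:
  assumes "v \<in> V" "w \<in> V"
  shows "transmission v \<le> (real (card V) - 1) * d v w + transmission w"
proof -
  have "card V \<ge> 1"
    using finite_V V_nonempty by (simp add: Suc_le_eq card_gt_0_iff)
  have tri: "real (d v z) \<le> real (d v w) + real (d w z)" if "z \<in> V" for z
    using d_triangle[OF assms that] by linarith
  have "transmission v = (\<Sum>z\<in>V - {v}. real (d v z))"
    unfolding transmission_def using finite_V assms by (subst sum.remove[of _ v]) (auto simp: gdist_self)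
  also have "\<dots> \<le> (\<Sum>z\<in>V - {v}. real (d v w) + real (d w z))"
    using tri by (intro sum_mono) auto
  also have "\<dots> = (real (card V) - 1) * d v w + (\<Sum>z\<in>V - {v}. real (d w z))"
    using assms \<open>card V \<ge> 1\<close> finite_V by (simp add: sum.distrib card_Diff_singleton of_nat_diff)
  also have "(\<Sum>z\<in>V - {v}. real (d w z)) \<le> transmission w"
    unfolding transmission_def using finite_V by (intro sum_mono2) auto
  finally show ?thesis by simp
qed

text \<open>Double counting: the diagonal contributes 0, and each two-element set comes from two
  ordered pairs with the same distance.\<close>

lemma sum_transmission: "(\<Sum>v\<in>V. transmission v) = 2 * real (wiener_index V E)"
proof -
  define P where "P = {p \<in> V \<times> V. fst p \<noteq> snd p}"
  define T where "T = {S. S \<subseteq> V \<and> card S = 2}"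
  define D where "D S = (THE k. \<exists>x y. S = {x, y} \<and> k = d x y)" for S
  have "finite P" "finite T"
    using finite_V by (auto simp: P_def T_def)
  have "(\<Sum>v\<in>V. transmission v) = (\<Sum>p\<in>V \<times> V. real (d (fst p) (snd p)))"
    unfolding transmission_def by (simp add: sum.cartesian_product case_prod_unfold)
  also have "\<dots> = (\<Sum>p\<in>P. real (d (fst p) (snd p)))"
    using finite_V by (intro sum.mono_neutral_right) (auto simp: P_def gdist_self)
  also have "\<dots> = (\<Sum>S\<in>T. \<Sum>p\<in>{p \<in> P. {fst p, snd p} = S}. real (d (fst p) (snd p)))"
    using \<open>finite P\<close> \<open>finite T\<close> by (intro sum.group[symmetric]) (auto simp: P_def T_def)
  also have "\<dots> = (\<Sum>S\<in>T. 2 * real (D S))"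
  proof (intro sum.cong refl)
    fix S assume "S \<in> T"
    then obtain a b where S: "S = {a, b}" "a \<noteq> b" "a \<in> V" "b \<in> V"
      by (auto simp: T_def card_2_iff)
    then have "{p \<in> P. {fst p, snd p} = S} = {(a, b), (b, a)}"
      by (auto simp: P_def doubleton_eq_iff)
    moreover have "D S = d a b"
      unfolding D_def S by (rule the_gdist)
    ultimately show "(\<Sum>p\<in>{p \<in> P. {fst p, snd p} = S}. real (d (fst p) (snd p))) = 2 * real (D S)"
      using S by (simp add: gdist_commute[of V E b a])
  qed
  also have "\<dots> = 2 * real (wiener_index V E)"
    by (simp add: wiener_index_def D_def T_def sum_distrib_left)
  finally show ?thesis .
qed

section \<open>Hitting times and cover costs of a tree\<close>

lemma hitting_time_tree:
  assumes "v \<in> V" "w \<in> V"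
  shows "hitting_time E v w =
    ennreal ((real (card V) - 1) * d v w + transmission w - transmission v)"
proof (rule hitting_time_eqI[where V = V])
  let ?g = "\<lambda>v. (real (card V) - 1) * d v w + transmission w - transmission v"
  fix x assume x: "x \<in> V" "x \<noteq> w"
  show nb: "N x \<subseteq> V \<and> N x \<noteq> {}"
    using closer_neighbour[of x w] x assms edge_in_V by blast
  have "card (N x) > 0"
    using nb finite_N by (simp add: card_gt_0_iff)
  moreover have "(\<Sum>y\<in>N x. ?g y) = (real (card V) - 1) * (\<Sum>y\<in>N x. real (d y w))
      + card (N x) * transmission w - (\<Sum>y\<in>N x. transmission y)"
    by (simp add: sum_subtractf sum.distrib sum_distrib_left)
  \<comment> \<open>The corrections \<open>2 * (card V - 1)\<close> from the distance and from the
    transmission cancel; per neighbour there remains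
    \<open>(card V - 1) - card V = -1\<close>.\<close>
  then have "(\<Sum>y\<in>N x. ?g y) = card (N x) * (?g x - 1)"
    unfolding sum_d_neighbours[OF x(1) assms(2)] sum_transmission_neighbours[OF x(1)]
    using x by (simp add: algebra_simps)
  ultimately show "?g x = 1 + (\<Sum>y\<in>N x. ?g y) / card (N x)"
    by simp
next
  fix x assume "x \<in> V"
  then show "0 \<le> (real (card V) - 1) * d x w + transmission w - transmission x"
    using transmission_le[of x w] assms by simp
qed (use assms finite_V in \<open>auto simp: gdist_self\<close>)

text \<open>Summing the hitting times over the target leaves
  \<open>(card V - 1) - card V = -1\<close> times the transmission. The second claim ensures that
  \<open>ennreal\<close> does not truncate a negative number to 0.\<close>

lemma cover_cost_tree:
  assumes "v \<in> V"
  shows "cover_cost V E v = ennreal (2 * real (wiener_index V E) - transmission v)"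
    and "transmission v \<le> 2 * real (wiener_index V E)"
proof -
  let ?h = "\<lambda>w. (real (card V) - 1) * d v w + transmission w - transmission v"
  have nonneg: "?h w \<ge> 0" if "w \<in> V" for w
    using transmission_le[OF assms that] by simp
  have "(\<Sum>w\<in>V. ?h w) = (real (card V) - 1) * transmission v + (\<Sum>w\<in>V. transmission w)
      - card V * transmission v"
    by (simp add: sum_subtractf sum.distrib sum_distrib_left transmission_def)
  then have sum: "(\<Sum>w\<in>V. ?h w) = 2 * real (wiener_index V E) - transmission v"
    unfolding sum_transmission by (simp add: algebra_simps)
  have "cover_cost V E v = (\<Sum>w\<in>V. ennreal (?h w))"
    unfolding cover_cost_def using assms by (intro sum.cong) (auto simp: hitting_time_tree)
  also have "\<dots> = ennreal (\<Sum>w\<in>V. ?h w)"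
    using nonneg by (intro sum_ennreal) auto
  finally show "cover_cost V E v = ennreal (2 * real (wiener_index V E) - transmission v)"
    unfolding sum .
  show "transmission v \<le> 2 * real (wiener_index V E)"
    using sum_nonneg[of V ?h] nonneg unfolding sum by simp
qed

text \<open>Now the start varies, so the transmission of \<open>v\<close> enters with the positive
  sign: \<open>(card V - 1) + card V\<close> times, by symmetry of the distance. The second claim
  again rules out truncation.\<close>

lemma reverse_cover_cost_tree:
  assumes "v \<in> V"
  shows "reverse_cover_cost V E v =
      ennreal ((2 * real (card V) - 1) * transmission v - 2 * real (wiener_index V E))"
    and "2 * real (wiener_index V E) \<le> (2 * real (card V) - 1) * transmission v"
proof -
  let ?h = "\<lambda>w. (real (card V) - 1) * d w v + transmission v - transmission w"
  have nonneg: "?h w \<ge> 0" if "w \<in> V" for w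
    using transmission_le[OF that assms] by simp
  have "(\<Sum>w\<in>V. ?h w) = (real (card V) - 1) * transmission v + card V * transmission v
      - (\<Sum>w\<in>V. transmission w)"
    by (simp add: sum_subtractf sum.distrib sum_distrib_left transmission_def gdist_commute[of V E v])
  then have sum: "(\<Sum>w\<in>V. ?h w) = (2 * real (card V) - 1) * transmission v - 2 * real (wiener_index V E)"
    unfolding sum_transmission by (simp add: algebra_simps)
  have "reverse_cover_cost V E v = (\<Sum>w\<in>V. ennreal (?h w))"
    unfolding reverse_cover_cost_def using assms by (intro sum.cong) (auto simp: hitting_time_tree)
  also have "\<dots> = ennreal (\<Sum>w\<in>V. ?h w)"
    using nonneg by (intro sum_ennreal) auto
  finally show "reverse_cover_cost V E v =
      ennreal ((2 * real (card V) - 1) * transmission v - 2 * real (wiener_index V E))"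
    unfolding sum .
  show "2 * real (wiener_index V E) \<le> (2 * real (card V) - 1) * transmission v"
    using sum_nonneg[of V ?h] nonneg unfolding sum by simp
qed

text \<open>The cover cost is a constant minus the transmission, so the order is reversed.
  Nonnegativity of the smaller side lets \<open>ennreal\<close> reflect strict inequalities.\<close>

lemma cover_cost_less_iff:
  assumes "u \<in> V" "v \<in> V"
  shows "cover_cost V E u < cover_cost V E v \<longleftrightarrow> transmission v < transmission u"
  using assms cover_cost_tree(2)[of u] by (simp add: cover_cost_tree(1) ennreal_less_iff)

lemma reverse_cover_cost_less_iff:
  assumes "u \<in> V" "v \<in> V"
  shows "reverse_cover_cost V E u < reverse_cover_cost V E v \<longleftrightarrow> transmission u < transmission v"
proof -
  have "card V \<ge> 1"
    using finite_V V_nonempty by (simp add: Suc_le_eq card_gt_0_iff)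
  then have "2 * real (card V) - 1 > 0" by linarith
  then show ?thesis
    using assms reverse_cover_cost_tree(2)[of u]
    by (simp add: reverse_cover_cost_tree(1) ennreal_less_iff)
qed

lemma reverse_cover_cost_add_cover_cost:
  assumes "v \<in> V"
  shows "reverse_cover_cost V E v + of_nat (2 * card V - 1) * cover_cost V E v =
    of_nat (4 * (card V - 1) * wiener_index V E)"
proof -
  have "card V \<ge> 1"
    using finite_V V_nonempty by (simp add: Suc_le_eq card_gt_0_iff)
  \<comment> \<open>A tree has a vertex, so the truncated subtractions on naturals agree with the
    real ones.\<close>
  then have n: "real (2 * card V - 1) = 2 * real (card V) - 1"
    "real (card V - 1) = real (card V) - 1"
    by (simp_all add: of_nat_diff)
  let ?W = "real (wiener_index V E)" and ?t = "transmission v" and ?n = "real (card V)"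
  have "reverse_cover_cost V E v + of_nat (2 * card V - 1) * cover_cost V E v =
      ennreal ((2 * ?n - 1) * ?t - 2 * ?W) + ennreal (2 * ?n - 1) * ennreal (2 * ?W - ?t)"
    using assms by (simp only: ennreal_of_nat_eq_real_of_nat n cover_cost_tree(1) reverse_cover_cost_tree(1))
  also have "\<dots> = ennreal (((2 * ?n - 1) * ?t - 2 * ?W) + (2 * ?n - 1) * (2 * ?W - ?t))"
    using cover_cost_tree(2)[OF assms] reverse_cover_cost_tree(2)[OF assms] \<open>card V \<ge> 1\<close>
    by (simp add: ennreal_mult'[symmetric] ennreal_plus[symmetric] del: ennreal_plus)
  \<comment> \<open>The weight \<open>2 * ?n - 1\<close> makes the transmission cancel, leaving
    \<open>(2 * ?n - 1) * 2 * ?W - 2 * ?W\<close>.\<close>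
  also have "((2 * ?n - 1) * ?t - 2 * ?W) + (2 * ?n - 1) * (2 * ?W - ?t) =
      real (4 * (card V - 1) * wiener_index V E)"
    by (simp only: of_nat_mult n) (simp add: algebra_simps)
  finally show ?thesis
    by (simp only: ennreal_of_nat_eq_real_of_nat)
qed

end

theorem theorem2:
  fixes V :: "'a set" and E :: "'a set set" and n :: nat
  assumes "is_tree V E" and "card V = n"
  shows "(\<forall>v\<in>V. reverse_cover_cost V E v + of_nat (2 * n - 1) * cover_cost V E v
                  = of_nat (4 * (n - 1) * wiener_index V E))
       \<and> (\<forall>u\<in>V. \<forall>v\<in>V. reverse_cover_cost V E u + of_nat (2 * n - 1) * cover_cost V E u
                  = reverse_cover_cost V E v + of_nat (2 * n - 1) * cover_cost V E v)
       \<and> (\<forall>v\<in>V. is_arg_max (cover_cost V E) (\<lambda>u. u \<in> V) v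
                  \<longleftrightarrow> is_arg_min (reverse_cover_cost V E) (\<lambda>u. u \<in> V) v)
       \<and> (\<forall>v\<in>V. is_arg_max (reverse_cover_cost V E) (\<lambda>u. u \<in> V) v
                  \<longleftrightarrow> is_arg_min (cover_cost V E) (\<lambda>u. u \<in> V) v)"
proof -
  interpret finite_tree V E
    using assms(1) by unfold_locales
  show ?thesis
    \<comment> \<open>Extremality is defined by the absence of a strictly better vertex. By the two
      comparison lemmas, both sides of the first equivalence say that \<open>v\<close> minimizes the
      transmission, and both sides of the second that it maximizes it.\<close>
    using reverse_cover_cost_add_cover_cost assms(2)
    by (auto simp: is_arg_max_def is_arg_min_def cover_cost_less_iff reverse_cover_cost_less_iff)
qed

end
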